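(* Let $k\ge 1$ and let $n_1\ge n_2\ge\dots\ge n_k\ge1$ be integers. Let $\mathbf{R}$ be the solvable Leibniz algebra over $\mathbb{C}$ with basis $e_1,\dots,e_{n_1+\dots+n_k+1},h,x_1,\dots,x_{k+1}$ and the following multiplication table (omitted products are zero), where $1\le j\le k-1$: $$\begin{array}{ll} [e_1,e_1]=h,\quad [h,x_1]=2h, &\\ {[e_i,e_1]}=-[e_1,e_i]=e_{i+1}, & 2\le i\le n_1,\\ {[e_{n_1+\dots+n_j+i},e_1]}=-[e_1,e_{n_1+\dots+n_j+i}]=e_{n_1+\dots+n_j+1+i}, & 2\le i\le n_{j+1},\\ {[e_1,x_1]}=-[x_1,e_1]=e_1, &\\ {[e_i,x_1]}=-[x_1,e_i]=(i-2)e_i, & 3\le i\le n_1+1,\\ {[e_{n_1+\dots+n_j+i},x_1]}=-[x_1,e_{n_1+\dots+n_j+i}]=(i-2)e_{n_1+\dots+n_j+i}, & 2\le i\le n_{j+1},\\ {[e_i,x_2]}=-[x_2,e_i]=e_i, & 2\le i\le n_1+1,\\ {[e_{n_1+\dots+n_j+i},x_{j+2}]}=-[x_{j+2},e_{n_1+\dots+n_j+i}]=e_{n_1+\dots+n_j+i}, & 2\le i\le n_{j+1}. \end{array}$$ Then $\mathbf{R}$ is complete, and its second cohomology group with coefficients in itself is trivial: $\mathrm{HL}^2(\mathbf{R},\mathbf{R})=0$.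
   Context: A (right) Leibniz algebra is a vector space with a bilinear product satisfying $[x,[y,z]]=[[x,y],z]-[[x,z],y]$. For a Leibniz algebra $L$: $\mathrm{Center}(L)=\{x\in L: [x,y]=[y,x]=0 \text{ for all } y\in L\}$. A derivation of $L$ is a linear map $d:L\to L$ with $d([x,y])=[d(x),y]+[x,d(y)]$; for $x\in L$ the right multiplication $\mathcal{R}_x:y\mapsto[y,x]$ is a derivation, and derivations of this form are called inner. $L$ is complete if $\mathrm{Center}(L)=0$ and every derivation of $L$ is inner. $\mathrm{HL}^2(L,L)=\mathrm{ZL}^2(L,L)/\mathrm{BL}^2(L,L)$, where $\mathrm{ZL}^2(L,L)$ is the space of bilinear maps $\varphi:L\times L\to L$ satisfying, for all $x,y,z\in L$, $$[x,\varphi(y,z)]-[\varphi(x,y),z]+[\varphi(x,z),y]+\varphi(x,[y,z])-\varphi([x,y],z)+\varphi([x,z],y)=0,$$ and $\mathrm{BL}^2(L,L)$ is the space of bilinear maps $\psi$ of the form $\psi(x,y)=[d(x),y]+[x,d(y)]-d([x,y])$ for some linear map $d:L\to L$.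
   Formalization: In the two rows giving the actions of x_1 and x_{j+2} on e_{n_1+…+n_j+i}, the range 2≤i≤n_{j+1} is corrected to 2≤i≤n_{j+1}+1; as printed, for k≥2 the table is not Leibniz or the center is nonzero. *)

theory Defs
  imports Complex_Main
begin

definition (in vector_space) bilinear_map :: "('b \<Rightarrow> 'b \<Rightarrow> 'b) \<Rightarrow> bool" where
  "bilinear_map f \<longleftrightarrow>
     (\<forall>x. Vector_Spaces.linear scale scale (f x)) \<and>
     (\<forall>y. Vector_Spaces.linear scale scale (\<lambda>x. f x y))"

definition (in vector_space) basis_family :: "'i set \<Rightarrow> ('i \<Rightarrow> 'b) \<Rightarrow> bool" where
  "basis_family I b \<longleftrightarrow> inj_on b I \<and> independent (b ` I) \<and> span (b ` I) = UNIV"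

locale leibniz_algebra = vector_space scale
  for scale :: "'a::field \<Rightarrow> 'b::ab_group_add \<Rightarrow> 'b" +
  fixes br :: "'b \<Rightarrow> 'b \<Rightarrow> 'b"
  assumes bilinear_br: "bilinear_map br"
    and leibniz_identity: "br x (br y z) = br (br x y) z - br (br x z) y"
begin

definition center :: "'b set" where
  "center = {x. \<forall>y. br x y = 0 \<and> br y x = 0}"

definition derivation :: "('b \<Rightarrow> 'b) \<Rightarrow> bool" where
  "derivation d \<longleftrightarrow> Vector_Spaces.linear scale scale d \<and>
     (\<forall>x y. d (br x y) = br (d x) y + br x (d y))"

definition right_mult :: "'b \<Rightarrow> 'b \<Rightarrow> 'b" where
  "right_mult x = (\<lambda>y. br y x)"

definition inner :: "('b \<Rightarrow> 'b) \<Rightarrow> bool" where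
  "inner d \<longleftrightarrow> (\<exists>x. d = right_mult x)"

definition complete :: bool where
  "complete \<longleftrightarrow> center = {0} \<and> (\<forall>d. derivation d \<longrightarrow> inner d)"

primrec derived_series :: "nat \<Rightarrow> 'b set" where
  "derived_series 0 = UNIV"
| "derived_series (Suc s) =
     span {br x y |x y. x \<in> derived_series s \<and> y \<in> derived_series s}"

definition solvable :: bool where
  "solvable \<longleftrightarrow> (\<exists>s. derived_series s = {0})"

definition ZL2 :: "('b \<Rightarrow> 'b \<Rightarrow> 'b) set" where
  "ZL2 = {\<phi>. bilinear_map \<phi> \<and>
     (\<forall>x y z. br x (\<phi> y z) - br (\<phi> x y) z + br (\<phi> x z) y
              + \<phi> x (br y z) - \<phi> (br x y) z + \<phi> (br x z) y = 0)}"

definition BL2 :: "('b \<Rightarrow> 'b \<Rightarrow> 'b) set" where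
  "BL2 = {\<psi>. \<exists>d. Vector_Spaces.linear scale scale d \<and>
     \<psi> = (\<lambda>x y. br (d x) y + br x (d y) - d (br x y))}"

definition cohomologous :: "(('b \<Rightarrow> 'b \<Rightarrow> 'b) \<times> ('b \<Rightarrow> 'b \<Rightarrow> 'b)) set" where
  "cohomologous = {(\<phi>, \<psi>). \<phi> \<in> ZL2 \<and> \<psi> \<in> ZL2 \<and> (\<lambda>x y. \<phi> x y - \<psi> x y) \<in> BL2}"

definition HL2 :: "('b \<Rightarrow> 'b \<Rightarrow> 'b) set set" where
  "HL2 = ZL2 // cohomologous"

lemma BL2_subset_ZL2: "BL2 \<subseteq> ZL2"
proof
  fix \<psi> assume "\<psi> \<in> BL2"
  then obtain d where d: "Vector_Spaces.linear scale scale d"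
    and \<psi>: "\<psi> = (\<lambda>x y. br (d x) y + br x (d y) - d (br x y))"
    unfolding BL2_def by blast
  interpret d: Vector_Spaces.linear scale scale d by (rule d)
  have lr: "Vector_Spaces.linear scale scale (br x)" for x
    using bilinear_br unfolding bilinear_map_def by blast
  have ll: "Vector_Spaces.linear scale scale (\<lambda>x. br x y)" for y
    using bilinear_br unfolding bilinear_map_def by blast
  note hr = Vector_Spaces.linear.axioms(3)[OF lr] and hl = Vector_Spaces.linear.axioms(3)[OF ll]
  have rs: "br x (y + z) = br x y + br x z" "br x (y - z) = br x y - br x z"
    "br x (scale c y) = scale c (br x y)" for x y z c
    using module_hom.add[OF hr] module_hom.diff[OF hr] module_hom.scale[OF hr] by auto
  have ls: "br (x + y) z = br x z + br y z" "br (x - y) z = br x z - br y z"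
    "br (scale c x) z = scale c (br x z)" for x y z c
    using module_hom.add[OF hl] module_hom.diff[OF hl] module_hom.scale[OF hl] by auto
  have "bilinear_map \<psi>"
    unfolding bilinear_map_def \<psi> Vector_Spaces.linear_iff
    by (auto simp: rs ls d.add d.scale algebra_simps scale_right_distrib scale_right_diff_distrib
        intro: vector_space_axioms)
  then show "\<psi> \<in> ZL2"
    unfolding ZL2_def \<psi>
    by (simp add: rs ls d.add d.diff leibniz_identity algebra_simps)
qed

lemma BL2_diff: "(\<lambda>x y. \<phi> x y - \<psi> x y) \<in> BL2" if mem: "\<phi> \<in> BL2" "\<psi> \<in> BL2"
proof -
  obtain d d' where d: "Vector_Spaces.linear scale scale d"
    and \<phi>: "\<phi> = (\<lambda>x y. br (d x) y + br x (d y) - d (br x y))"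
    and d': "Vector_Spaces.linear scale scale d'"
    and \<psi>: "\<psi> = (\<lambda>x y. br (d' x) y + br x (d' y) - d' (br x y))"
    using mem unfolding BL2_def by blast
  have hr: "module_hom scale scale (br x)" and hl: "module_hom scale scale (\<lambda>x. br x y)" for x y
    using bilinear_br Vector_Spaces.linear.axioms(3) unfolding bilinear_map_def by blast+
  have "Vector_Spaces.linear scale scale (\<lambda>x. d x - d' x)"
    using d d' unfolding Vector_Spaces.linear_iff
    by (auto simp: algebra_simps scale_right_diff_distrib)
  then show ?thesis
    unfolding BL2_def \<phi> \<psi>
    by (auto intro!: exI[of _ "\<lambda>x. d x - d' x"]
        simp: module_hom.diff[OF hr] module_hom.diff[OF hl] fun_eq_iff)
qed

lemma zero_in_BL2: "(\<lambda>x y. 0) \<in> BL2"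
proof -
  have "Vector_Spaces.linear scale scale (\<lambda>x. 0)"
    unfolding Vector_Spaces.linear_iff by (auto intro: vector_space_axioms)
  moreover have "br 0 y = 0" "br x 0 = 0" for x y
    using bilinear_br Vector_Spaces.linear.axioms(3) module_hom.zero
    unfolding bilinear_map_def by blast+
  ultimately show ?thesis
    unfolding BL2_def by (auto intro!: exI[of _ "\<lambda>x. 0"])
qed

lemma equiv_cohomologous: "equiv ZL2 cohomologous"
proof (rule equivI)
  show "sym cohomologous"
    unfolding sym_def cohomologous_def
    using BL2_diff[OF zero_in_BL2] by fastforce
  show "trans cohomologous"
  proof (rule transI)
    fix \<phi> \<psi> \<chi> assume A: "(\<phi>, \<psi>) \<in> cohomologous" "(\<psi>, \<chi>) \<in> cohomologous"
    then have "(\<lambda>x y. 0 - (\<psi> x y - \<chi> x y)) \<in> BL2"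
      unfolding cohomologous_def using BL2_diff[OF zero_in_BL2] by fast
    with A show "(\<phi>, \<chi>) \<in> cohomologous"
      unfolding cohomologous_def
      using BL2_diff[of "\<lambda>x y. \<phi> x y - \<psi> x y" "\<lambda>x y. 0 - (\<psi> x y - \<chi> x y)"] by simp
  qed
qed (auto simp: refl_on_def cohomologous_def zero_in_BL2)

lemma zero_class: "cohomologous `` {\<lambda>x y. 0} = BL2"
proof -
  have "(\<lambda>x y. - \<psi> x y) \<in> BL2 \<longleftrightarrow> \<psi> \<in> BL2" for \<psi>
    using BL2_diff[OF zero_in_BL2, of \<psi>] BL2_diff[OF zero_in_BL2, of "\<lambda>x y. - \<psi> x y"]
    by auto
  then show ?thesis
    using zero_in_BL2 BL2_subset_ZL2 unfolding cohomologous_def by auto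
qed

text \<open>The quotient space is zero iff its only element is the zero class, which is
  \<open>BL2\<close> by the preceding lemma.\<close>

definition HL2_trivial :: bool where
  "HL2_trivial \<longleftrightarrow> HL2 = {BL2}"

end

text \<open>Generators of the algebra: \<open>E i\<close>, \<open>H\<close> and \<open>X i\<close> stand for
  $e_i$, $h$ and $x_i$; indices start at 1.\<close>

datatype gen = E nat | H | X nat

definition psum :: "(nat \<Rightarrow> nat) \<Rightarrow> nat \<Rightarrow> nat" where
  "psum n j = (\<Sum>l = 1..j. n l)"

definition gens :: "nat \<Rightarrow> (nat \<Rightarrow> nat) \<Rightarrow> gen set" where
  "gens k n = E ` {1..psum n k + 1} \<union> {H} \<union> X ` {1..k + 1}"

text \<open>\<open>entry k n a b c g\<close> means that $[a,b] = c\,g$ is a listed product. The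
  generators \<open>E (psum n j + i)\<close> with $2 \le i \le n_{j+1}+1$ form one block, and
  $x_1$, $x_{j+2}$ act on the whole of it. (If their action stopped at $i = n_{j+1}$, the
  Leibniz identity would fail when $n_{j+1} \ge 2$, and the center would be nonzero when
  $n_{j+1} = 1$.)\<close>

inductive entry :: "nat \<Rightarrow> (nat \<Rightarrow> nat) \<Rightarrow> gen \<Rightarrow> gen \<Rightarrow> complex \<Rightarrow> gen \<Rightarrow> bool"
  for k :: nat and n :: "nat \<Rightarrow> nat" where
  "entry k n (E 1) (E 1) 1 H"
| "entry k n H (X 1) 2 H"
| "2 \<le> i \<Longrightarrow> i \<le> n 1 \<Longrightarrow> entry k n (E i) (E 1) 1 (E (i + 1))"
| "2 \<le> i \<Longrightarrow> i \<le> n 1 \<Longrightarrow> entry k n (E 1) (E i) (-1) (E (i + 1))"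
| "1 \<le> j \<Longrightarrow> j < k \<Longrightarrow> 2 \<le> i \<Longrightarrow> i \<le> n (j + 1) \<Longrightarrow>
     entry k n (E (psum n j + i)) (E 1) 1 (E (psum n j + 1 + i))"
| "1 \<le> j \<Longrightarrow> j < k \<Longrightarrow> 2 \<le> i \<Longrightarrow> i \<le> n (j + 1) \<Longrightarrow>
     entry k n (E 1) (E (psum n j + i)) (-1) (E (psum n j + 1 + i))"
| "entry k n (E 1) (X 1) 1 (E 1)"
| "entry k n (X 1) (E 1) (-1) (E 1)"
| "3 \<le> i \<Longrightarrow> i \<le> n 1 + 1 \<Longrightarrow> entry k n (E i) (X 1) (of_nat i - 2) (E i)"
| "3 \<le> i \<Longrightarrow> i \<le> n 1 + 1 \<Longrightarrow> entry k n (X 1) (E i) (- (of_nat i - 2)) (E i)"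
| "1 \<le> j \<Longrightarrow> j < k \<Longrightarrow> 2 \<le> i \<Longrightarrow> i \<le> n (j + 1) + 1 \<Longrightarrow>
     entry k n (E (psum n j + i)) (X 1) (of_nat i - 2) (E (psum n j + i))"
| "1 \<le> j \<Longrightarrow> j < k \<Longrightarrow> 2 \<le> i \<Longrightarrow> i \<le> n (j + 1) + 1 \<Longrightarrow>
     entry k n (X 1) (E (psum n j + i)) (- (of_nat i - 2)) (E (psum n j + i))"
| "2 \<le> i \<Longrightarrow> i \<le> n 1 + 1 \<Longrightarrow> entry k n (E i) (X 2) 1 (E i)"
| "2 \<le> i \<Longrightarrow> i \<le> n 1 + 1 \<Longrightarrow> entry k n (X 2) (E i) (-1) (E i)"
| "1 \<le> j \<Longrightarrow> j < k \<Longrightarrow> 2 \<le> i \<Longrightarrow> i \<le> n (j + 1) + 1 \<Longrightarrow>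
     entry k n (E (psum n j + i)) (X (j + 2)) 1 (E (psum n j + i))"
| "1 \<le> j \<Longrightarrow> j < k \<Longrightarrow> 2 \<le> i \<Longrightarrow> i \<le> n (j + 1) + 1 \<Longrightarrow>
     entry k n (X (j + 2)) (E (psum n j + i)) (-1) (E (psum n j + i))"

definition multiplication_table ::
  "nat \<Rightarrow> (nat \<Rightarrow> nat) \<Rightarrow> (complex \<Rightarrow> 'b \<Rightarrow> 'b) \<Rightarrow> ('b::ab_group_add \<Rightarrow> 'b \<Rightarrow> 'b) \<Rightarrow> (gen \<Rightarrow> 'b) \<Rightarrow> bool"
where
  "multiplication_table k n scale br v \<longleftrightarrow>
     (\<forall>a b c g. entry k n a b c g \<longrightarrow> br (v a) (v b) = scale c (v g)) \<and>
     (\<forall>a \<in> gens k n. \<forall>b \<in> gens k n. (\<nexists>c g. entry k n a b c g) \<longrightarrow> br (v a) (v b) = 0)"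

end

theory Submission
  imports Defs
begin

text \<open>
  The nilradical is spanned by \<open>e = e_1\<close>, \<open>h\<close> and \<open>k\<close> blocks of pairwise commuting vectors, each of
  which is a chain under right multiplication by \<open>e\<close>. The torus \<open>x_1, ..., x_{k+1}\<close> acts
  diagonally on it: \<open>x_1\<close> counts the position in a block (and gives \<open>e\<close> weight 1, \<open>h\<close> weight 2), and each other
  \<open>x_l\<close> is the identity on one block. The nilradical has pairwise different
  nonzero weights, which makes everything rigid. The weights are handled with one generic element \<open>t\<close>
  of the torus, with one complex number \<open>gwt g\<close> for each basis vector; by \<open>gwt_generic\<close> this number
  carries the information about sums of weights that is needed.

  A derivation can be made to commute with right multiplication by \<open>t\<close> by subtracting an inner one
  (\<open>derivation_inner\<close>). It then scales each vector of the nilradical and is determined by the scalars on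
  \<open>e\<close> and on the first vectors of the blocks, which can be prescribed by a torus element
  (\<open>weight_zero_derivation\<close>).

  For the second cohomology, the cocycle condition with a fixed third argument \<open>z\<close> says that the image of
  \<open>\<phi>\<close> under the action of \<open>z\<close> is the coboundary of \<open>\<lambda>u. \<phi> u z\<close> (\<open>act_eq_delta\<close>). With \<open>z = t\<close> this allows
  \<open>\<phi>\<close> to be replaced by an invariant cocycle (\<open>invariant_representative\<close>). For an invariant cocycle the
  maps \<open>\<lambda>u. \<phi> u (x l)\<close> are derivations of weight zero, hence inner, and can be removed (\<open>kill_torus\<close>).
  The cocycle that remains vanishes if an argument is in the torus or equals \<open>h\<close>; for reasons of weight
  it only rescales the products of the nilradical, and since the nonzero ones among these
  form chains, a rescaling of the basis vectors absorbs it (\<open>torus_free_coboundary\<close>).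
\<close>

section \<open>Labels and weights\<close>

text \<open>A renaming of the generators that makes the block structure visible: \<open>Lf j i\<close> is the
  \<open>i\<close>-th vector of the \<open>j\<close>-th block and \<open>Lx l\<close> is a torus element, all counted from 0, so that
  \<open>Lx (Suc j)\<close> is the torus element that belongs to the \<open>j\<close>-th block.\<close>

datatype label = Le | Lh | Lx nat | Lf nat nat

definition labels :: "nat \<Rightarrow> (nat \<Rightarrow> nat) \<Rightarrow> label set" where
  "labels k m = {Le, Lh} \<union> Lx ` {..k} \<union> (\<Union>j<k. Lf j ` {..<m j})"

lemma finite_labels [simp]: "finite (labels k m)"
  by (auto simp: labels_def)

lemma in_labels [simp]:
  "Le \<in> labels k m" "Lh \<in> labels k m" "Lx l \<in> labels k m \<longleftrightarrow> l \<le> k"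
  "Lf j i \<in> labels k m \<longleftrightarrow> j < k \<and> i < m j"
  by (auto simp: labels_def)

primrec height :: "label \<Rightarrow> nat" where
  "height Le = 1"
| "height Lh = 2"
| "height (Lx _) = 0"
| "height (Lf j i) = i"

text \<open>Different blocks get different odd numbers, so that the sum of two of them is never
  the mark of a label.\<close>

primrec mark :: "label \<Rightarrow> nat" where
  "mark Le = 0"
| "mark Lh = 0"
| "mark (Lx _) = 0"
| "mark (Lf j i) = 2 * j + 1"

text \<open>The weight of a label on the \<open>l\<close>-th torus element. For \<open>l > 0\<close> only the labels of block \<open>l - 1\<close>,
  whose mark is \<open>2 * l - 1\<close>, have a nonzero weight.\<close>

definition wt :: "label \<Rightarrow> nat \<Rightarrow> complex" where
  "wt g l = (if l = 0 then of_nat (height g) else if mark g = 2 * l - 1 then 1 else 0)"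

text \<open>The weight for the single torus element $x_1 + \sum_j (2j+1)\,\mathrm{i}\, x_{j+2}$.\<close>

definition gwt :: "label \<Rightarrow> complex" where
  "gwt g = Complex (real (height g)) (real (mark g))"

lemma gwt_eq_add_iff: "gwt c = gwt a + gwt b \<longleftrightarrow> height c = height a + height b \<and> mark c = mark a + mark b"
  by (simp add: gwt_def complex_eq_iff flip: of_nat_add)

lemma gwt_eq_iff: "gwt a = gwt b \<longleftrightarrow> height a = height b \<and> mark a = mark b"
  by (simp add: gwt_def complex_eq_iff)

lemma gwt_eqD: "gwt a = gwt b \<Longrightarrow> a = b \<or> (\<exists>l l'. a = Lx l \<and> b = Lx l')"
  by (cases a; cases b) (auto simp: gwt_eq_iff)

lemma gwt_0_iff: "gwt a = 0 \<longleftrightarrow> (\<exists>l. a = Lx l)"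
  by (cases a) (auto simp: gwt_def complex_eq_iff)

text \<open>No additive relation between weights is gained by passing from the torus to this one
  element.\<close>

lemma gwt_generic:
  assumes "gwt c = gwt a + gwt b"
  shows "wt c l = wt a l + wt b l"
proof (cases "l = 0")
  case False
  have "mark c = mark a + mark b"
    using assms gwt_eq_add_iff by blast
  then have "mark a = 0 \<and> mark c = mark b \<or> mark b = 0 \<and> mark c = mark a"
    by (cases a; cases b; cases c) (simp_all, presburger)
  then show ?thesis
    using False by (auto simp: wt_def)
qed (use assms in \<open>simp add: wt_def gwt_eq_add_iff\<close>)

section \<open>The algebra in block notation\<close>

text \<open>Vectors outside the range of the labels are set to zero, so that the multiplication table
  holds for all indices.\<close>

locale block_leibniz = vector_space scale
  for scale :: "complex \<Rightarrow> 'b::ab_group_add \<Rightarrow> 'b" (infixr "*s" 75) +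
  fixes br :: "'b \<Rightarrow> 'b \<Rightarrow> 'b" and k :: nat and m :: "nat \<Rightarrow> nat"
    and e h :: 'b and x :: "nat \<Rightarrow> 'b" and f :: "nat \<Rightarrow> nat \<Rightarrow> 'b"
  assumes bilinear: "bilinear_map br"
    and basis: "basis_family (labels k m) (case_label e h x f)"
    and m_pos: "\<And>j. j < k \<Longrightarrow> m j > 0"
    and x_zero: "\<And>l. \<not> l \<le> k \<Longrightarrow> x l = 0"
    and f_zero: "\<And>j i. \<not> (j < k \<and> i < m j) \<Longrightarrow> f j i = 0"
    and br_nil: "br e e = h" "br e h = 0" "br h e = 0" "br h h = 0"
      "\<And>j i. br (f j i) e = f j (Suc i)" "\<And>j i. br e (f j i) = - f j (Suc i)"
      "\<And>j i. br h (f j i) = 0" "\<And>j i. br (f j i) h = 0" "\<And>j i j' i'. br (f j i) (f j' i') = 0"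
    and br_torus: "\<And>l l'. br (x l) (x l') = 0" "\<And>l. br (x l) h = 0"
      "\<And>l. br e (x l) = wt Le l *s e" "\<And>l. br (x l) e = - (wt Le l *s e)"
      "\<And>l. br h (x l) = wt Lh l *s h"
      "\<And>j i l. br (f j i) (x l) = wt (Lf j i) l *s f j i"
      "\<And>j i l. br (x l) (f j i) = - (wt (Lf j i) l *s f j i)"
begin

abbreviation "L \<equiv> labels k m"

definition b :: "label \<Rightarrow> 'b" where
  "b = case_label e h x f"

lemma b_simps [simp]: "b Le = e" "b Lh = h" "b (Lx l) = x l" "b (Lf j i) = f j i"
  by (simp_all add: b_def)

lemma b_zero: "g \<notin> L \<Longrightarrow> b g = 0"
  by (cases g) (auto simp: x_zero f_zero)

lemma linear_br_left: "Vector_Spaces.linear scale scale (\<lambda>u. br u v)"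
  using bilinear by (auto simp: bilinear_map_def)

lemma bilinear_mapD:
  assumes "bilinear_map \<phi>"
  shows "\<phi> (u + u') v = \<phi> u v + \<phi> u' v" "\<phi> u (v + v') = \<phi> u v + \<phi> u v'"
    "\<phi> (u - u') v = \<phi> u v - \<phi> u' v" "\<phi> u (v - v') = \<phi> u v - \<phi> u v'"
    "\<phi> (- u) v = - \<phi> u v" "\<phi> u (- v) = - \<phi> u v"
    "\<phi> (c *s u) v = c *s \<phi> u v" "\<phi> u (c *s v) = c *s \<phi> u v"
    "\<phi> 0 v = 0" "\<phi> u 0 = 0"
proof -
  have l: "module_hom scale scale (\<lambda>u. \<phi> u v)" and r: "module_hom scale scale (\<phi> u)" for u v
    using assms Vector_Spaces.linear.axioms(3) unfolding bilinear_map_def by blast+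
  show "\<phi> (u + u') v = \<phi> u v + \<phi> u' v" "\<phi> u (v + v') = \<phi> u v + \<phi> u v'"
    "\<phi> (u - u') v = \<phi> u v - \<phi> u' v" "\<phi> u (v - v') = \<phi> u v - \<phi> u v'"
    "\<phi> (- u) v = - \<phi> u v" "\<phi> u (- v) = - \<phi> u v"
    "\<phi> (c *s u) v = c *s \<phi> u v" "\<phi> u (c *s v) = c *s \<phi> u v"
    "\<phi> 0 v = 0" "\<phi> u 0 = 0"
    using module_hom.add[OF l] module_hom.add[OF r] module_hom.diff[OF l] module_hom.diff[OF r]
      module_hom.neg[OF l] module_hom.neg[OF r] module_hom.scale[OF l] module_hom.scale[OF r]
      module_hom.zero[OF l] module_hom.zero[OF r] by auto
qed

lemmas br_lin [simp] = bilinear_mapD[OF bilinear]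

lemma linearD:
  assumes "Vector_Spaces.linear scale scale d"
  shows "d (u + v) = d u + d v" "d (u - v) = d u - d v" "d (- u) = - d u" "d (c *s u) = c *s d u"
    "d 0 = 0"
  using assms Vector_Spaces.linear.axioms(3) module_hom.add module_hom.diff module_hom.neg
    module_hom.scale module_hom.zero by metis+

lemma linearI:
  assumes "\<And>u v. d (u + v) = d u + d v" "\<And>c u. d (c *s u) = c *s d u"
  shows "Vector_Spaces.linear scale scale d"
  using assms vector_space_axioms by (simp add: Vector_Spaces.linear_iff)

lemma bilinear_mapI:
  assumes "\<And>u u' v. \<phi> (u + u') v = \<phi> u v + \<phi> u' v" "\<And>u v v'. \<phi> u (v + v') = \<phi> u v + \<phi> u v'"
    "\<And>c u v. \<phi> (c *s u) v = c *s \<phi> u v" "\<And>c u v. \<phi> u (c *s v) = c *s \<phi> u v"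
  shows "bilinear_map \<phi>"
  using assms vector_space_axioms by (simp add: bilinear_map_def Vector_Spaces.linear_iff)

lemmas scale_simps = scale_right_distrib scale_left_distrib scale_right_diff_distrib
  scale_left_diff_distrib

definition coord :: "'b \<Rightarrow> label \<Rightarrow> complex" where
  "coord u g = representation (b ` L) u (b g)"

lemma basis_b: "inj_on b L" "independent (b ` L)" "span (b ` L) = UNIV"
  using basis by (auto simp: basis_family_def b_def)

lemma coord_add [simp]: "coord (u + v) g = coord u g + coord v g"
  by (simp add: coord_def representation_add basis_b)

lemma coord_scale [simp]: "coord (c *s u) g = c * coord u g"
  by (simp add: coord_def representation_scale basis_b)

lemma coord_zero [simp]: "coord 0 g = 0"
  by (simp add: coord_def representation_zero)

lemma coord_diff [simp]: "coord (u - v) g = coord u g - coord v g"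
  by (simp add: coord_def representation_diff basis_b)

lemma coord_minus [simp]: "coord (- u) g = - coord u g"
  by (simp add: coord_def representation_neg basis_b)

lemma coord_b: "g \<in> L \<Longrightarrow> g' \<in> L \<Longrightarrow> coord (b g) g' = (if g' = g then 1 else 0)"
  using basis_b inj_on_eq_iff[OF basis_b(1)] by (simp add: coord_def representation_basis)

lemma coord_sum [simp]: "coord (\<Sum>i\<in>I. u i) g = (\<Sum>i\<in>I. coord (u i) g)"
  by (induction I rule: infinite_finite_induct) auto

lemma expand: "(\<Sum>g\<in>L. coord u g *s b g) = u"
proof -
  have "(\<Sum>g\<in>L. coord u g *s b g) = (\<Sum>v\<in>b ` L. representation (b ` L) u v *s v)"
    by (simp add: sum.reindex basis_b coord_def)
  then show ?thesis
    by (simp add: sum_representation_eq basis_b)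
qed

lemma vec_eqI: "(\<And>g. g \<in> L \<Longrightarrow> coord u g = coord v g) \<Longrightarrow> u = v"
  using expand[of u] expand[of v] by (metis (no_types, lifting) sum.cong)

lemma vec_induct [case_names basis add scale]:
  assumes "\<And>g. P (b g)" "\<And>u v. P u \<Longrightarrow> P v \<Longrightarrow> P (u + v)" "\<And>c u. P u \<Longrightarrow> P (c *s u)"
  shows "P u"
proof -
  have zero: "P 0"
    using assms(3)[OF assms(1), of 0] by simp
  have "P (\<Sum>g\<in>I. coord u g *s b g)" if "finite I" for I
    using that by induction (auto intro: assms zero)
  from this[OF finite_labels[of k m]] show ?thesis
    by (simp add: expand)
qed

lemma bilinear_ext:
  assumes "bilinear_map \<phi>" "bilinear_map \<psi>" and "\<And>g g'. \<phi> (b g) (b g') = \<psi> (b g) (b g')"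
  shows "\<phi> u v = \<psi> u v"
proof (induction u rule: vec_induct)
  case (basis g)
  show ?case
    by (induction v rule: vec_induct) (use assms in \<open>simp_all add: bilinear_mapD\<close>)
qed (use assms in \<open>simp_all add: bilinear_mapD\<close>)

lemma linear_extension:
  assumes "\<And>g. g \<notin> L \<Longrightarrow> s g = 0"
  obtains d where "Vector_Spaces.linear scale scale d" "\<And>g. d (b g) = s g"
proof
  define d where "d u = (\<Sum>g\<in>L. coord u g *s s g)" for u
  show "Vector_Spaces.linear scale scale d"
    by (rule linearI) (simp_all add: d_def scale_simps sum.distrib scale_sum_right)
  fix g
  show "d (b g) = s g"
  proof (cases "g \<in> L")
    case True
    then have "d (b g) = (\<Sum>g'\<in>L. if g' = g then s g else 0)"
      unfolding d_def by (intro sum.cong) (auto simp: coord_b)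
    then show ?thesis
      using True by simp
  qed (simp add: d_def b_zero assms)
qed

lemma br_b_x: "br (b g) (x l) = wt g l *s b g"
  by (cases g) (simp_all add: br_torus wt_def)

lemma br_x_b: "g \<noteq> Lh \<Longrightarrow> br (x l) (b g) = - (wt g l *s b g)"
  by (cases g) (simp_all add: br_torus wt_def)

lemma br_h: "br u h = 0"
proof (induction u rule: vec_induct)
  case (basis g) then show ?case by (cases g) (simp_all add: br_nil br_torus)
qed simp_all

text \<open>Squares generate only the line of \<open>h\<close>, so the product is antisymmetric modulo this line.\<close>

lemma br_sym: "\<exists>c. br u v + br v u = c *s h"
proof -
  have *: "\<exists>c. br (b g) (b g') + br (b g') (b g) = c *s h" for g g'
    by (cases g; cases g')
      (auto simp: br_nil br_torus intro: exI[of _ 0] exI[of _ 2] exI[of _ "wt Lh l" for l]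
        simp flip: scale_left_distrib[of 1 1, simplified])
  have line_add: "\<exists>c. s + r = c *s h" if "\<exists>c. s = c *s h" "\<exists>c. r = c *s h" for s r
    using that scale_left_distrib by metis
  have line_scale: "\<exists>c. a *s s = c *s h" if "\<exists>c. s = c *s h" for a s
    using that by auto
  show ?thesis
  proof (induction u rule: vec_induct)
    case (basis g)
    show ?case
    proof (induction v rule: vec_induct)
      case (add v v')
      then show ?case using line_add[OF add.IH] by (simp add: algebra_simps)
    next
      case (scale c v)
      then show ?case using line_scale[OF scale.IH, of c] by (simp add: scale_simps)
    qed (rule *)
  next
    case (add u u')
    then show ?case using line_add[OF add.IH] by (simp add: algebra_simps)
  next
    case (scale c u)
    then show ?case using line_scale[OF scale.IH, of c] by (simp add: scale_simps)
  qed
qed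

text \<open>With the last argument in the torus the identity says that the product adds weights; on
  basis vectors of the nilradical it is nontrivial only if \<open>e\<close> occurs twice.\<close>

lemma leibniz: "br u (br v w) = br (br u v) w - br (br u w) v"
proof -
  have *: "br (b g) (br (b g') (b g'')) = br (br (b g) (b g')) (b g'') - br (br (b g) (b g'')) (b g')"
    for g g' g''
    using scale_left_distrib[of 1 1 h] by (cases g; cases g'; cases g'')
      (simp_all add: br_nil br_torus wt_def scale_simps)
  show ?thesis
  proof (induction u rule: vec_induct)
    case (basis g)
    show ?case
    proof (induction v rule: vec_induct)
      case (basis g')
      show ?case
        by (induction w rule: vec_induct) (simp_all add: * add_diff_add scale_simps)
    qed (simp_all add: add_diff_add scale_simps)
  qed (simp_all add: add_diff_add scale_simps)
qed

sublocale leibniz_algebra scale br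
  by unfold_locales (simp_all add: bilinear leibniz)

section \<open>Eigenspaces of a generic torus element\<close>

definition torus :: "(nat \<Rightarrow> complex) \<Rightarrow> 'b" where
  "torus c = (\<Sum>l\<le>k. c l *s x l)"

definition t :: 'b where
  "t = torus (\<lambda>l. if l = 0 then 1 else Complex 0 (real (2 * l - 1)))"

lemma bilinear_sum_right: "bilinear_map \<phi> \<Longrightarrow> \<phi> u (\<Sum>i\<in>I. v i) = (\<Sum>i\<in>I. \<phi> u (v i))"
  by (induction I rule: infinite_finite_induct) (simp_all add: bilinear_mapD)

lemma bilinear_sum_left: "bilinear_map \<phi> \<Longrightarrow> \<phi> (\<Sum>i\<in>I. v i) u = (\<Sum>i\<in>I. \<phi> (v i) u)"
  by (induction I rule: infinite_finite_induct) (simp_all add: bilinear_mapD)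

lemma br_b_torus: "br (b g) (torus c) = (\<Sum>l\<le>k. c l * wt g l) *s b g"
  unfolding torus_def by (simp add: bilinear_sum_right bilinear br_b_x scale_sum_left)

lemma br_torus_b: "g \<noteq> Lh \<Longrightarrow> br (torus c) (b g) = - ((\<Sum>l\<le>k. c l * wt g l) *s b g)"
  unfolding torus_def by (simp add: bilinear_sum_left bilinear br_x_b scale_sum_left sum_negf)

lemma sum_wt:
  assumes "g \<in> L"
  shows "(\<Sum>l\<le>k. c l * wt g l) =
    c 0 * of_nat (height g) + (case g of Lf j i \<Rightarrow> c (Suc j) | _ \<Rightarrow> 0)"
proof -
  have "(\<Sum>l\<le>k. c l * wt g l) = c 0 * of_nat (height g) + (\<Sum>l<k. c (Suc l) * wt g (Suc l))"
    unfolding lessThan_Suc_atMost[symmetric] sum.lessThan_Suc_shift by (simp add: wt_def)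
  also have "(\<Sum>l<k. c (Suc l) * wt g (Suc l)) = (\<Sum>l<k. case g of Lf j i \<Rightarrow> if l = j then c (Suc j) else 0 | _ \<Rightarrow> 0)"
    by (intro sum.cong) (auto simp: wt_def split: label.split)
  also have "\<dots> = (case g of Lf j i \<Rightarrow> c (Suc j) | _ \<Rightarrow> 0)"
    using assms by (cases g) auto
  finally show ?thesis .
qed

lemma sum_wt_t:
  assumes "g \<in> L"
  shows "(\<Sum>l\<le>k. (if l = 0 then 1 else Complex 0 (real (2 * l - 1))) * wt g l) = gwt g"
  unfolding sum_wt[OF assms] by (cases g) (simp_all add: gwt_def complex_eq_iff)

lemma br_b_t: "br (b g) t = gwt g *s b g"
  using sum_wt_t b_zero by (cases "g \<in> L") (simp_all add: t_def br_b_torus)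

lemma br_t_b: "g \<noteq> Lh \<Longrightarrow> br t (b g) = - (gwt g *s b g)"
  using sum_wt_t b_zero by (cases "g \<in> L") (simp_all add: t_def br_torus_b)

lemma br_torus_torus: "br (torus c) (torus c') = 0"
  by (simp add: torus_def bilinear_sum_left bilinear_sum_right bilinear br_torus)

lemma br_x_torus: "br (x l) (torus c) = 0"
  by (simp add: torus_def bilinear_sum_right bilinear br_torus)

lemma coord_br_t: "g \<in> L \<Longrightarrow> coord (br u t) g = gwt g * coord u g"
proof (induction u rule: vec_induct)
  case (basis g')
  then show ?case
    by (cases "g' \<in> L") (auto simp: br_b_t coord_b b_zero)
qed (simp_all add: algebra_simps)

lemma coord_eigenvector:
  assumes "br u t = c *s u" "g \<in> L" "gwt g \<noteq> c"
  shows "coord u g = 0"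
  using coord_br_t[OF assms(2), of u] assms by auto

lemma simple_eigenvector:
  assumes u: "br u t = gwt g *s u" and g: "\<nexists>l. g = Lx l"
  obtains c where "u = c *s b g"
proof
  have "coord u g' = 0" if "g' \<in> L" "g' \<noteq> g" for g'
    using coord_eigenvector[OF u that(1)] gwt_eqD[of g' g] g that by blast
  then show "u = (if g \<in> L then coord u g else 0) *s b g"
    by (intro vec_eqI) (auto simp: coord_b)
qed

lemma kernel_t:
  assumes "br u t = 0"
  obtains c where "u = torus c"
proof
  have "u = (\<Sum>g\<in>L. coord u g *s b g)"
    by (simp add: expand)
  also have "\<dots> = (\<Sum>g\<in>Lx ` {..k}. coord u g *s b g)"
    using coord_eigenvector[of u 0] assms gwt_0_iff by (intro sum.mono_neutral_right) force+
  also have "\<dots> = torus (\<lambda>l. coord u (Lx l))"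
    by (simp add: sum.reindex inj_on_def torus_def)
  finally show "u = torus (\<lambda>l. coord u (Lx l))" .
qed

lemma torus_t: "br (torus c) t = 0"
  by (simp add: t_def br_torus_torus)

lemma not_eigenvalue:
  assumes "br u t = c *s u" "\<And>g. gwt g \<noteq> c"
  shows "u = 0"
  using coord_eigenvector[OF assms(1)] assms(2) by (intro vec_eqI) simp

text \<open>Right multiplication by \<open>t\<close> is diagonalizable: an eigenvector that lies in the image of the
  operator shifted by its eigenvalue is zero.\<close>

lemma no_generalized_eigenvector:
  assumes "v = br u t - c *s u" "br v t = c *s v"
  shows "v = 0"
proof (rule vec_eqI)
  fix g assume g: "g \<in> L"
  have "coord v g = (gwt g - c) * coord u g"
    using g by (simp add: assms(1) coord_br_t algebra_simps)
  then show "coord v g = coord 0 g"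
    using coord_eigenvector[OF assms(2) g] by auto
qed

text \<open>The other consequence of diagonalizability: the space is the sum of the image and the kernel of
  the shifted operator.\<close>

lemma solve_mod_eigenspace: "\<exists>v. br (br v t - c *s v - u) t = c *s (br v t - c *s v - u)"
proof (induction u rule: vec_induct)
  case (basis g)
  show ?case
  proof (cases "gwt g = c")
    case True
    then show ?thesis by (intro exI[of _ 0]) (simp add: br_b_t)
  next
    case False
    then have "(gwt g / (gwt g - c)) *s b g - (c / (gwt g - c)) *s b g = b g"
      by (simp add: divide_simps flip: scale_left_diff_distrib)
    then show ?thesis using False
      by (intro exI[of _ "(1 / (gwt g - c)) *s b g"]) (simp add: br_b_t)
  qed
next
  case (add u v)
  then obtain u' v' where
    "br (br u' t - c *s u' - u) t = c *s (br u' t - c *s u' - u)"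
    "br (br v' t - c *s v' - v) t = c *s (br v' t - c *s v' - v)" by blast
  then have "br ((br u' t - c *s u' - u) + (br v' t - c *s v' - v)) t
      = c *s ((br u' t - c *s u' - u) + (br v' t - c *s v' - v))"
    by (simp only: br_lin scale_right_distrib)
  then show ?case
    by (intro exI[of _ "u' + v'"]) (simp add: algebra_simps scale_simps)
next
  case (scale a u)
  then obtain u' where "br (br u' t - c *s u' - u) t = c *s (br u' t - c *s u' - u)" by blast
  then have "br (a *s (br u' t - c *s u' - u)) t = c *s (a *s (br u' t - c *s u' - u))"
    by (simp only: br_lin scale_left_commute)
  then show ?case
    by (intro exI[of _ "a *s u'"]) (simp add: algebra_simps scale_simps)
qed

lemma torus_eq_0:
  assumes "br e (torus c) = 0" "\<And>j. j < k \<Longrightarrow> br (f j 0) (torus c) = 0"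
  shows "torus c = 0"
proof -
  have nz: "b g \<noteq> 0" if "g \<in> L" for g
    using coord_b[OF that that] by auto
  have c0: "c 0 = 0"
    using assms(1) br_b_torus[of Le c] sum_wt[of Le c] nz[of Le] by simp
  have "c (Suc j) = 0" if "j < k" for j
    using assms(2)[OF that] br_b_torus[of "Lf j 0" c] sum_wt[of "Lf j 0" c] nz[of "Lf j 0"] that m_pos
    by simp
  with c0 have "c l = 0" if "l \<le> k" for l
    using that by (cases l) auto
  then show ?thesis by (simp add: torus_def)
qed

text \<open>Left multiplication by \<open>t\<close> has the eigenvalue \<open>- gwt g\<close> on every basis vector other than \<open>h\<close>, so
  \<open>u\<close> is a multiple of \<open>h\<close> plus a torus element, and the latter is zero because
  the torus acts faithfully on \<open>e\<close> and the blocks.\<close>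

lemma right_annihilator:
  assumes "\<And>v. br v u = 0"
  obtains c where "u = c *s h"
proof -
  have "coord u g = 0" if "g \<in> L" "g \<noteq> Lh" "gwt g \<noteq> 0" for g
  proof -
    have "coord (br t v) g = - (gwt g * coord v g)" for v
    proof (induction v rule: vec_induct)
      case (basis g')
      show ?case
        using that coord_b[of Lh g]
        by (cases "g' \<in> L"; cases "g' = Lh") (auto simp: br_t_b coord_b b_zero br_h)
    qed (simp_all add: algebra_simps)
    from this[of u] show ?thesis using assms that by simp
  qed
  then have "br (u - coord u Lh *s h) t = 0"
    by (intro vec_eqI) (use coord_b[of Lh] in \<open>force simp: coord_br_t\<close>)
  then obtain c where c: "u - coord u Lh *s h = torus c"
    by (rule kernel_t)
  have "br v (torus c) = 0" for v
    using assms by (simp add: br_h flip: c)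
  then have "torus c = 0"
    by (intro torus_eq_0)
  with c that show ?thesis by simp
qed

section \<open>Completeness\<close>

lemma derivationD:
  assumes "derivation d"
  shows "Vector_Spaces.linear scale scale d" "d (br u v) = br (d u) v + br u (d v)"
  using assms by (auto simp: derivation_def)

lemma derivation_right_mult: "derivation (right_mult u)"
  by (simp add: derivation_def right_mult_def linear_br_left leibniz[of _ _ u] leibniz)

lemma derivation_diff: "derivation d \<Longrightarrow> derivation d' \<Longrightarrow> derivation (\<lambda>u. d u - d' u)"
  by (auto simp: derivation_def linearD algebra_simps scale_simps intro!: linearI)

text \<open>Such a derivation scales \<open>e\<close> and the first vector \<open>f j 0\<close> of each block, and these are as many
  scalars as the torus has dimensions. Once an inner derivation with the same scalars is subtracted, the
  generators \<open>e\<close> and \<open>f j 0\<close> of the nilradical go to zero, hence so does the whole nilradical, and the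
  torus must go to zero because it acts faithfully on the nilradical.\<close>

lemma weight_zero_derivation:
  assumes d: "derivation d" and inv: "\<And>u. d (br u t) = br (d u) t"
  obtains c where "d = right_mult (torus c)"
proof -
  note dlin = linearD[OF derivationD(1)[OF d]]
  have "br (d (b g)) t = gwt g *s d (b g)" for g
    using inv[of "b g"] by (simp add: br_b_t dlin)
  then have "\<exists>c. d (b g) = c *s b g" if "\<nexists>l. g = Lx l" for g
    using that simple_eigenvector by blast
  then obtain c where c: "d (b g) = c g *s b g" if "\<nexists>l. g = Lx l" for g
    by metis
  define \<gamma> where "\<gamma> l = (case l of 0 \<Rightarrow> c Le | Suc j \<Rightarrow> c (Lf j 0))" for l
  define d' where "d' u = d u - right_mult (torus \<gamma>) u" for u
  have d': "derivation d'"
    unfolding d'_def by (intro derivation_diff d derivation_right_mult)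
  note lin = linearD[OF derivationD(1)[OF d']] and der = derivationD(2)[OF d']
  have e: "d' e = 0"
    using c[of Le] br_b_torus[of Le \<gamma>] sum_wt[of Le \<gamma>] by (simp add: d'_def right_mult_def \<gamma>_def)
  then have h: "d' h = 0"
    using der[of e e] by (simp add: br_nil)
  have f: "d' (f j i) = 0" for j i
  proof (induction i)
    case 0
    show ?case
    proof (cases "Lf j 0 \<in> L")
      case True
      then show ?thesis
        using c[of "Lf j 0"] br_b_torus[of "Lf j 0" \<gamma>] sum_wt[of "Lf j 0" \<gamma>]
        by (simp add: d'_def right_mult_def \<gamma>_def)
    qed (use b_zero[of "Lf j 0"] lin in simp)
  next
    case (Suc i)
    then show ?case using der[of "f j i" e] e by (simp add: br_nil)
  qed
  have x: "d' (x l) = 0" for l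
  proof -
    have "br (d' (x l)) t = 0"
      using inv[of "x l"] by (simp add: d'_def right_mult_def dlin br_x_torus t_def)
    then obtain \<delta> where \<delta>: "d' (x l) = torus \<delta>"
      by (rule kernel_t)
    have "br e (torus \<delta>) = 0" "br (f j 0) (torus \<delta>) = 0" for j
      using der[of e "x l"] der[of "f j 0" "x l"] by (simp_all add: br_torus lin e f \<delta>)
    then show ?thesis
      using torus_eq_0 \<delta> by simp
  qed
  have "d' u = 0" for u
  proof (induction u rule: vec_induct)
    case (basis g) then show ?case by (cases g) (simp_all add: e h f x)
  qed (simp_all add: lin)
  then show ?thesis
    by (intro that[of \<gamma>]) (simp add: d'_def fun_eq_iff)
qed

lemma derivation_inner:
  assumes d: "derivation d"
  shows "inner d"
proof -
  \<comment> \<open>Subtract an inner derivation so that \<open>t\<close> goes to a torus element plus a multiple of \<open>h\<close>.\<close>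
  obtain v where v: "br (br v t - d t) t = 0"
    using solve_mod_eigenspace[of 0 "d t"] by auto
  then obtain \<gamma> where \<gamma>: "br v t - d t = torus \<gamma>"
    by (rule kernel_t)
  obtain a where a: "br t v + br v t = a *s h"
    using br_sym by blast
  define d' where "d' u = d u - right_mult (- v) u" for u
  have d': "derivation d'"
    unfolding d'_def by (intro derivation_diff d derivation_right_mult)
  note lin = linearD[OF derivationD(1)[OF d']] and der = derivationD(2)[OF d']
  have "d' t = a *s h - torus \<gamma>"
    by (simp add: d'_def right_mult_def \<gamma>[symmetric] a[symmetric])
  then have d't: "d' (br u t) = br (d' u) t - br u (torus \<gamma>)" for u
    using der[of u t] by (simp add: br_h)
  \<comment> \<open>The diagonal entries of the commutator of a linear map with a diagonal map vanish.\<close>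
  have "br (b g) (torus \<gamma>) = 0" if "g \<in> L" for g
  proof -
    have *: "br (b g) (torus \<gamma>) = br (d' (b g)) t - gwt g *s d' (b g)"
      using d't[of "b g"] by (simp add: br_b_t lin)
    show ?thesis
      by (rule no_generalized_eigenvector[OF *])
        (simp add: br_b_torus br_b_t scale_left_commute mult.commute)
  qed
  from this[of Le] this[of "Lf _ 0"] have "torus \<gamma> = 0"
    by (intro torus_eq_0) (simp_all add: m_pos)
  then have "d' (br u t) = br (d' u) t" for u
    using d't by simp
  then obtain c where "d' = right_mult (torus c)"
    using weight_zero_derivation[OF d'] by blast
  then have "d = right_mult (- v + torus c)"
    unfolding d'_def right_mult_def fun_eq_iff br_lin by (simp add: algebra_simps)
  then show ?thesis
    unfolding inner_def by blast
qed

lemma center_trivial: "center = {0}"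
proof
  show "center \<subseteq> {0}"
  proof
    fix u assume "u \<in> center"
    then have central: "br u v = 0" "br v u = 0" for v
      by (simp_all add: center_def)
    obtain c where "u = torus c"
      using kernel_t central by blast
    then show "u \<in> {0}" using central torus_eq_0 by simp
  qed
qed (simp add: center_def)

lemma complete: complete
  by (simp add: complete_def center_trivial derivation_inner)

section \<open>Vanishing of the second cohomology\<close>

definition \<delta> :: "('b \<Rightarrow> 'b) \<Rightarrow> 'b \<Rightarrow> 'b \<Rightarrow> 'b" where
  "\<delta> d u v = br (d u) v + br u (d v) - d (br u v)"

text \<open>Right multiplication by \<open>z\<close>, extended to bilinear maps as a derivation.\<close>

definition act :: "'b \<Rightarrow> ('b \<Rightarrow> 'b \<Rightarrow> 'b) \<Rightarrow> 'b \<Rightarrow> 'b \<Rightarrow> 'b" where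
  "act z \<phi> u v = br (\<phi> u v) z - \<phi> (br u z) v - \<phi> u (br v z)"

lemma BL2_iff: "\<phi> \<in> BL2 \<longleftrightarrow> (\<exists>d. Vector_Spaces.linear scale scale d \<and> (\<forall>u v. \<phi> u v = \<delta> d u v))"
  by (auto simp: BL2_def \<delta>_def fun_eq_iff)

lemma delta_BL2: "Vector_Spaces.linear scale scale d \<Longrightarrow> \<delta> d \<in> BL2"
  by (auto simp: BL2_iff)

lemma ZL2D:
  assumes "\<phi> \<in> ZL2"
  shows "bilinear_map \<phi>"
    "br u (\<phi> v w) - br (\<phi> u v) w + br (\<phi> u w) v + \<phi> u (br v w) - \<phi> (br u v) w + \<phi> (br u w) v = 0"
  using assms by (auto simp: ZL2_def)

lemma ZL2_diff:
  assumes "\<phi> \<in> ZL2" "\<psi> \<in> ZL2"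
  shows "(\<lambda>u v. \<phi> u v - \<psi> u v) \<in> ZL2"
proof -
  note bl = bilinear_mapD[OF ZL2D(1)[OF assms(1)]] bilinear_mapD[OF ZL2D(1)[OF assms(2)]]
  have "bilinear_map (\<lambda>u v. \<phi> u v - \<psi> u v)"
    by (rule bilinear_mapI) (simp_all add: bl algebra_simps scale_simps)
  moreover have
    "br u (\<phi> v w - \<psi> v w) - br (\<phi> u v - \<psi> u v) w + br (\<phi> u w - \<psi> u w) v
      + (\<phi> u (br v w) - \<psi> u (br v w)) - (\<phi> (br u v) w - \<psi> (br u v) w)
      + (\<phi> (br u w) v - \<psi> (br u w) v) = 0" for u v w
  proof -
    have "?thesis \<longleftrightarrow> (br u (\<phi> v w) - br (\<phi> u v) w + br (\<phi> u w) v + \<phi> u (br v w)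
        - \<phi> (br u v) w + \<phi> (br u w) v)
      - (br u (\<psi> v w) - br (\<psi> u v) w + br (\<psi> u w) v + \<psi> u (br v w)
        - \<psi> (br u v) w + \<psi> (br u w) v) = 0"
      by (simp add: algebra_simps)
    then show ?thesis by (simp only: ZL2D(2)[OF assms(1)] ZL2D(2)[OF assms(2)] diff_self)
  qed
  ultimately show ?thesis by (simp add: ZL2_def)
qed

lemma cohomologous_cocycle:
  assumes "\<phi> \<in> ZL2" "Vector_Spaces.linear scale scale d"
  shows "(\<lambda>u v. \<phi> u v - \<delta> d u v) \<in> ZL2"
    "(\<lambda>u v. \<phi> u v - \<delta> d u v) \<in> BL2 \<Longrightarrow> \<phi> \<in> BL2"
proof -
  show "(\<lambda>u v. \<phi> u v - \<delta> d u v) \<in> ZL2"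
    using assms ZL2_diff delta_BL2 BL2_subset_ZL2 by blast
  assume "(\<lambda>u v. \<phi> u v - \<delta> d u v) \<in> BL2"
  then obtain d' where d': "Vector_Spaces.linear scale scale d'" "\<And>u v. \<phi> u v - \<delta> d u v = \<delta> d' u v"
    unfolding BL2_iff by blast
  have "Vector_Spaces.linear scale scale (\<lambda>u. d u + d' u)"
    by (rule linearI) (simp_all add: linearD[OF assms(2)] linearD[OF d'(1)] algebra_simps scale_simps)
  moreover have "\<phi> u v = \<delta> (\<lambda>u. d u + d' u) u v" for u v
    using d'(2)[of u v] by (simp add: \<delta>_def algebra_simps)
  ultimately show "\<phi> \<in> BL2"
    unfolding BL2_iff by blast
qed

text \<open>Cartan's formula: inner derivations act trivially on cohomology. It is the cocycle condition with
  \<open>z\<close> as third argument.\<close>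

lemma act_eq_delta:
  assumes "\<phi> \<in> ZL2"
  shows "act z \<phi> u v = \<delta> (\<lambda>w. \<phi> w z) u v"
  using ZL2D(2)[OF assms, of u v z] by (simp add: act_def \<delta>_def algebra_simps)

lemma act_delta:
  assumes "Vector_Spaces.linear scale scale d"
  shows "act z (\<delta> d) u v = \<delta> (\<lambda>w. br (d w) z - d (br w z)) u v"
proof -
  have right: "br (br u v) z = br (br u z) v + br u (br v z)" for u v z
    using leibniz[of u v z] by (simp add: algebra_simps)
  show ?thesis
    by (simp add: act_def \<delta>_def linearD[OF assms] right[of "d u" v z] right[of u "d v" z]
        right[of u v z] algebra_simps)
qed

lemma act_diff: "act z (\<lambda>u v. \<phi> u v - \<psi> u v) u v = act z \<phi> u v - act z \<psi> u v"
  by (simp add: act_def algebra_simps)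

text \<open>Averaging over the torus. A linear map \<open>d\<close> is chosen whose image under the action of \<open>t\<close> agrees with
  \<open>\<lambda>u. \<phi> u t\<close> up to an invariant map \<open>q\<close>. By Cartan's formula \<open>t\<close> maps
  \<open>\<phi> - \<delta> d\<close> to \<open>- \<delta> q\<close>, which is invariant; as \<open>t\<close> acts diagonalizably, \<open>\<phi> - \<delta> d\<close> is then
  itself invariant.\<close>

lemma invariant_representative:
  assumes \<phi>: "\<phi> \<in> ZL2"
  obtains d where "Vector_Spaces.linear scale scale d"
    "\<And>u v. act t (\<lambda>u v. \<phi> u v - \<delta> d u v) u v = 0"
proof -
  note bl = bilinear_mapD[OF ZL2D(1)[OF \<phi>]]
  have "\<forall>g. \<exists>v. (g \<notin> L \<longrightarrow> v = 0) \<and> br (br v t - gwt g *s v - \<phi> (b g) t) t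
      = gwt g *s (br v t - gwt g *s v - \<phi> (b g) t)"
  proof
    fix g
    show "\<exists>v. (g \<notin> L \<longrightarrow> v = 0) \<and> br (br v t - gwt g *s v - \<phi> (b g) t) t
      = gwt g *s (br v t - gwt g *s v - \<phi> (b g) t)"
      by (cases "g \<in> L") (use solve_mod_eigenspace in \<open>simp_all add: b_zero bl\<close>)
  qed
  then obtain s where s: "\<And>g. g \<notin> L \<Longrightarrow> s g = 0"
    "\<And>g. br (br (s g) t - gwt g *s s g - \<phi> (b g) t) t
      = gwt g *s (br (s g) t - gwt g *s s g - \<phi> (b g) t)"
    by metis
  obtain d where d: "Vector_Spaces.linear scale scale d" "\<And>g. d (b g) = s g"
    using linear_extension[of s] s(1) by metis
  define q where "q u = br (d u) t - d (br u t) - \<phi> u t" for u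
  have qlin: "Vector_Spaces.linear scale scale q"
    by (rule linearI) (simp_all add: q_def linearD[OF d(1)] bl algebra_simps scale_simps)
  have q: "br (q u) t - q (br u t) = 0" for u
  proof (induction u rule: vec_induct)
    case (basis g)
    have "q (b g) = br (s g) t - gwt g *s s g - \<phi> (b g) t"
      by (simp add: q_def d br_b_t linearD[OF d(1)])
    then show ?case
      using s(2)[of g] by (simp add: br_b_t linearD[OF qlin])
  next
    case (scale c u)
    then show ?case by (simp add: linearD[OF qlin] flip: scale_right_diff_distrib)
  qed (simp_all add: linearD[OF qlin] algebra_simps)
  define \<phi>' where "\<phi>' u v = \<phi> u v - \<delta> d u v" for u v
  have \<phi>'bl: "bilinear_map \<phi>'"
    using cohomologous_cocycle(1)[OF \<phi> d(1)] ZL2D(1) unfolding \<phi>'_def by blast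
  have act1: "act t \<phi>' u v = - \<delta> q u v" for u v
    unfolding \<phi>'_def act_diff act_eq_delta[OF \<phi>] act_delta[OF d(1)]
    by (simp add: \<delta>_def q_def algebra_simps)
  have "act t (\<delta> q) u v = 0" for u v
    unfolding act_delta[OF qlin] by (simp add: q \<delta>_def)
  moreover have "act t (\<lambda>u v. - \<delta> q u v) u v = - act t (\<delta> q) u v" for u v
    by (simp add: act_def)
  moreover have "act t \<phi>' = (\<lambda>u v. - \<delta> q u v)"
    by (intro ext act1)
  ultimately have act2: "act t (act t \<phi>') u v = 0" for u v
    by simp
  have "act t \<phi>' (b g) (b g') = 0" for g g'
  proof (rule no_generalized_eigenvector)
    show *: "act t \<phi>' (b g) (b g') = br (\<phi>' (b g) (b g')) t - (gwt g + gwt g') *s \<phi>' (b g) (b g')"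
      by (simp add: act_def br_b_t bilinear_mapD[OF \<phi>'bl] scale_simps)
    have "act t \<phi>' (br (b g) t) (b g') = gwt g *s act t \<phi>' (b g) (b g')"
      "act t \<phi>' (b g) (br (b g') t) = gwt g' *s act t \<phi>' (b g) (b g')"
      by (simp_all add: act_def br_b_t bilinear_mapD[OF \<phi>'bl] scale_simps)
    then show "br (act t \<phi>' (b g) (b g')) t = (gwt g + gwt g') *s act t \<phi>' (b g) (b g')"
      using act2[of "b g" "b g'"] unfolding act_def[of t "act t \<phi>'"]
      by (simp add: scale_simps algebra_simps)
  qed
  moreover have "bilinear_map (act t \<phi>')"
    by (rule bilinear_mapI) (simp_all add: act_def bilinear_mapD[OF \<phi>'bl] scale_simps algebra_simps)
  moreover have "bilinear_map (\<lambda>u v. 0 :: 'b)"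
    by (rule bilinear_mapI) simp_all
  ultimately have "act t \<phi>' u v = 0" for u v
    using bilinear_ext by metis
  then show ?thesis
    using that d(1) unfolding \<phi>'_def by blast
qed

text \<open>Since \<open>t\<close> is generic, an invariant of \<open>t\<close> is an invariant of the torus.\<close>

lemma torus_invariant:
  assumes bl: "bilinear_map \<phi>" and inv: "\<And>u v. act t \<phi> u v = 0"
  shows "act (x l) \<phi> u v = 0"
proof -
  note bls = bilinear_mapD[OF bl]
  have "act (x l) \<phi> (b g) (b g') = 0" for g g'
  proof -
    have ev: "br (\<phi> (b g) (b g')) t = (gwt g + gwt g') *s \<phi> (b g) (b g')"
      using inv[of "b g" "b g'"] by (simp add: act_def br_b_t bls scale_simps algebra_simps)
    have "coord w g'' *s br (b g'') (x l) = (wt g l + wt g' l) *s (coord w g'' *s b g'')"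
      if "w = \<phi> (b g) (b g')" "g'' \<in> L" for w g''
      using coord_eigenvector[OF ev that(2)] gwt_generic[of g'' g g' l] that
      by (cases "gwt g'' = gwt g + gwt g'") (simp_all add: br_b_x mult.commute)
    note * = this[OF refl]
    have "br (\<Sum>g''\<in>L. coord (\<phi> (b g) (b g')) g'' *s b g'') (x l)
      = (wt g l + wt g' l) *s (\<Sum>g''\<in>L. coord (\<phi> (b g) (b g')) g'' *s b g'')"
      using * by (simp add: bilinear_sum_left[OF bilinear] scale_sum_right)
    then have "br (\<phi> (b g) (b g')) (x l) = (wt g l + wt g' l) *s \<phi> (b g) (b g')"
      unfolding expand .
    then show ?thesis
      by (simp add: act_def br_b_x bls scale_simps algebra_simps)
  qed
  moreover have "bilinear_map (act (x l) \<phi>)"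
    by (rule bilinear_mapI) (simp_all add: act_def bls scale_simps algebra_simps)
  moreover have "bilinear_map (\<lambda>u v. 0 :: 'b)"
    by (rule bilinear_mapI) simp_all
  ultimately show ?thesis
    using bilinear_ext by metis
qed

text \<open>By Cartan's formula and invariance, \<open>\<lambda>u. \<phi> u (x l)\<close> is a derivation of weight zero, so it is right
  multiplication by a torus element; taking this element as the value of \<open>d\<close> at \<open>x l\<close>
  removes it.\<close>

lemma kill_torus:
  assumes \<phi>: "\<phi> \<in> ZL2" and inv: "\<And>u v. act t \<phi> u v = 0"
  obtains d where "Vector_Spaces.linear scale scale d"
    "\<And>u l. \<phi> u (x l) - \<delta> d u (x l) = 0"
proof -
  note bl = bilinear_mapD[OF ZL2D(1)[OF \<phi>]]
  have "\<exists>c. (\<lambda>u. \<phi> u (x l)) = right_mult (torus c)" for l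
  proof -
    have "derivation (\<lambda>u. \<phi> u (x l))"
      unfolding derivation_def
    proof (intro conjI allI)
      show "Vector_Spaces.linear scale scale (\<lambda>u. \<phi> u (x l))"
        by (rule linearI) (simp_all add: bl)
      show "\<phi> (br u v) (x l) = br (\<phi> u (x l)) v + br u (\<phi> v (x l))" for u v
        using torus_invariant[OF ZL2D(1)[OF \<phi>] inv, of l u v]
        by (simp add: act_eq_delta[OF \<phi>] \<delta>_def)
    qed
    moreover have "\<phi> (br u t) (x l) = br (\<phi> u (x l)) t" for u
      using inv[of u "x l"] br_b_t[of "Lx l"] gwt_0_iff[of "Lx l"] by (simp add: act_def bl)
    ultimately show ?thesis
      using weight_zero_derivation by metis
  qed
  then obtain c where c: "\<And>u l. \<phi> u (x l) = br u (torus (c l))"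
    unfolding right_mult_def by metis
  obtain d where d: "Vector_Spaces.linear scale scale d"
    "\<And>g. d (b g) = (case g of Lx l \<Rightarrow> if l \<le> k then torus (c l) else 0 | _ \<Rightarrow> 0)"
    by (rule linear_extension[of "\<lambda>g. case g of Lx l \<Rightarrow> if l \<le> k then torus (c l) else 0 | _ \<Rightarrow> 0"])
      (auto split: label.split)
  have dx: "br u (d (x l)) = br u (torus (c l))" for u l
    using d(2)[of "Lx l"] c[of u l] by (cases "l \<le> k") (simp_all add: x_zero bl)
  have "\<phi> u (x l) - \<delta> d u (x l) = 0" for u l
  proof (induction u rule: vec_induct)
    case (basis g)
    have "br (d (b g)) (x l) - d (br (b g) (x l)) = 0"
      unfolding br_b_x linearD(4)[OF d(1)] d(2)
      by (cases g) (simp_all add: torus_def bilinear_sum_left[OF bilinear] br_torus wt_def)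
    then show ?case by (simp add: \<delta>_def dx c)
  next
    case (scale a u)
    then show ?case
      by (simp add: \<delta>_def bl linearD[OF d(1)] flip: scale_right_diff_distrib scale_right_distrib)
  qed (simp add: \<delta>_def bl linearD[OF d(1)] algebra_simps)
  then show ?thesis
    using that d(1) by blast
qed

text \<open>Cartan's formula makes \<open>\<phi>\<close> invariant, so \<open>\<phi>\<close> of two basis vectors is a multiple of a basis
  vector or zero. Next \<open>\<phi> u h = 0\<close>, and then the cocycle condition puts \<open>\<phi> v w + \<phi> w v\<close> into the right
  annihilator, which is the line of \<open>h\<close>; by weight this sum vanishes on most pairs of basis
  vectors. What remains are the values on \<open>(e, e)\<close>, \<open>(f j i, e)\<close> and \<open>(e, f j i)\<close>, and these
  are the coboundary of a diagonal map, found by summing along each block.\<close>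

lemma torus_free_coboundary:
  assumes \<phi>: "\<phi> \<in> ZL2" and torus_free: "\<And>u l. \<phi> u (x l) = 0"
  shows "\<phi> \<in> BL2"
proof -
  note bl = bilinear_mapD[OF ZL2D(1)[OF \<phi>]]
  have free_torus: "\<phi> u (torus c) = 0" for u c
    by (simp add: torus_def bilinear_sum_right[OF ZL2D(1)[OF \<phi>]] bl torus_free)
  have inv_t: "br (\<phi> u v) t = \<phi> (br u t) v + \<phi> u (br v t)" for u v
    using act_eq_delta[OF \<phi>, of t u v] by (simp add: act_def \<delta>_def free_torus t_def algebra_simps)
  have weight: "br (\<phi> (b g) (b g')) t = (gwt g + gwt g') *s \<phi> (b g) (b g')" for g g'
    by (simp add: inv_t br_b_t bl scale_simps)
  have no_weight: "\<phi> (b g) (b g') = 0"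
    if "\<And>g''. height g'' = height g + height g' \<Longrightarrow> mark g'' = mark g + mark g' \<Longrightarrow> False" for g g'
    using not_eigenvalue[OF weight] that gwt_eq_add_iff by metis
  \<comment> \<open>The sum of the cocycle conditions for \<open>u, v, w\<close> and for \<open>u, w, v\<close>.\<close>
  have sym: "br u (\<phi> v w + \<phi> w v) = - \<phi> u (br v w + br w v)" for u v w
  proof -
    have "br u (\<phi> v w + \<phi> w v) + \<phi> u (br v w + br w v) = 0"
      using arg_cong2[where f="(+)", OF ZL2D(2)[OF \<phi>, of u v w] ZL2D(2)[OF \<phi>, of u w v]]
      by (simp add: bl algebra_simps)
    then show ?thesis by (simp add: eq_neg_iff_add_eq_0)
  qed
  have right_h: "\<phi> u h = 0" for u
  proof -
    have "gwt (Lx 0) + gwt Lh = gwt Lh"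
      by (simp add: gwt_def complex_eq_iff)
    then obtain c where "\<phi> (x 0) h = c *s h"
      using weight[of "Lx 0" Lh] simple_eigenvector[of "\<phi> (x 0) h" Lh] by auto
    \<comment> \<open>The argument in parentheses is \<open>2 h\<close>.\<close>
    then have "\<phi> u (br (x 0) h + br h (x 0)) = 0"
      using sym[of u "x 0" h] by (simp add: torus_free br_h)
    then show ?thesis
      by (simp add: br_torus wt_def bl)
  qed
  have line: "\<exists>c. \<phi> v w + \<phi> w v = c *s h" for v w
  proof -
    obtain c where "br v w + br w v = c *s h" using br_sym by blast
    then have "br u (\<phi> v w + \<phi> w v) = 0" for u
      using sym[of u v w] by (simp add: bl right_h)
    then show ?thesis using right_annihilator by metis
  qed
  have anti: "\<phi> (b g) (b g') + \<phi> (b g') (b g) = 0" if "gwt g + gwt g' \<noteq> 2" for g g'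
  proof -
    obtain c where c: "\<phi> (b g) (b g') + \<phi> (b g') (b g) = c *s h" using line by blast
    have "br (\<phi> (b g) (b g') + \<phi> (b g') (b g)) t
      = (gwt g + gwt g') *s (\<phi> (b g) (b g') + \<phi> (b g') (b g))"
      by (simp add: weight scale_right_distrib add.commute)
    then have "(2 * c) *s h = ((gwt g + gwt g') * c) *s h"
      unfolding c using br_b_t[of Lh] by (simp add: gwt_def complex_eq_iff mult.commute) 
    then have "2 * c = (gwt g + gwt g') * c"
      using coord_b[of Lh Lh] by (metis b_simps(2) coord_scale in_labels(2) mult_cancel_right zero_neq_one)
    then show ?thesis using that c by simp
  qed
  have torus_left: "\<phi> (x l) e = 0" "\<phi> (x l) (f j i) = 0" for l j i
    using anti[of "Lx l" Le] anti[of "Lx l" "Lf j i"]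
    by (simp_all add: torus_free gwt_def complex_eq_iff)
  have h_left: "\<phi> h e = 0" "\<phi> h (f j i) = 0" for j i
  proof -
    show "\<phi> h e = 0"
    proof -
      have "mark g = 0 \<Longrightarrow> height g \<noteq> 3" for g
        by (cases g) simp_all
      then show ?thesis
        using no_weight[of Lh Le] by force
    qed
    show "\<phi> h (f j i) = 0"
      using anti[of Lh "Lf j i"] by (simp add: right_h gwt_def complex_eq_iff)
  qed
  have ff: "\<phi> (f j i) (f j' i') = 0" for j i j' i'
  proof -
    have "mark g \<noteq> 2 * j + 1 + (2 * j' + 1)" for g
      by (cases g) (simp_all, presburger)
    then show ?thesis
      using no_weight[of "Lf j i" "Lf j' i'"] by simp
  qed
  have "gwt (Lf j i) + gwt Le = gwt (Lf j (Suc i))" for j i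
    by (simp add: gwt_def complex_eq_iff)
  then have "br (\<phi> (f j i) e) t = gwt (Lf j (Suc i)) *s \<phi> (f j i) e" for j i
    using weight[of "Lf j i" Le] by simp
  then have "\<exists>c. \<phi> (f j i) e = c *s f j (Suc i)" for j i
    using simple_eigenvector[of "\<phi> (f j i) e" "Lf j (Suc i)"] by (metis b_simps(4) label.distinct(11))
  then obtain \<mu> where fe: "\<And>j i. \<phi> (f j i) e = \<mu> j i *s f j (Suc i)"
    by metis
  have ef: "\<phi> e (f j i) = - (\<mu> j i *s f j (Suc i))" for j i
    using anti[of Le "Lf j i"] by (simp add: fe gwt_def complex_eq_iff eq_neg_iff_add_eq_0)
  have "gwt Le + gwt Le = gwt Lh"
    by (simp add: gwt_def complex_eq_iff)
  then obtain \<epsilon> where ee: "\<phi> e e = \<epsilon> *s h"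
    using weight[of Le Le] simple_eigenvector[of "\<phi> e e" Lh] by auto
  define \<kappa> where
    "\<kappa> g = (case g of Lh \<Rightarrow> - \<epsilon> | Lf j i \<Rightarrow> - (\<Sum>i'<i. \<mu> j i') | _ \<Rightarrow> 0)" for g
  obtain d where d: "Vector_Spaces.linear scale scale d" "\<And>g. d (b g) = \<kappa> g *s b g"
    by (rule linear_extension[of "\<lambda>g. \<kappa> g *s b g"]) (auto simp: b_zero)
  have d_simps: "d e = 0" "d h = - (\<epsilon> *s h)" "d (x l) = 0"
    "d (f j i) = - ((\<Sum>i'<i. \<mu> j i') *s f j i)" for l j i
    using d(2)[of Le] d(2)[of Lh] d(2)[of "Lx l"] d(2)[of "Lf j i"] by (simp_all add: \<kappa>_def)
  have basis_eq: "\<phi> (b g) (b g') = \<delta> d (b g) (b g')" for g g'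
    by (cases g; cases g')
      (simp_all add: \<delta>_def d_simps linearD[OF d(1)] br_nil br_torus ee ef fe ff h_left torus_left
        right_h torus_free scale_simps mult.commute)
  have "\<phi> u v = \<delta> d u v" for u v
    by (rule bilinear_ext[OF ZL2D(1)[OF \<phi>] ZL2D(1) basis_eq])
      (use delta_BL2[OF d(1)] BL2_subset_ZL2 in blast)
  then show ?thesis
    using d(1) BL2_iff by blast
qed

lemma ZL2_eq_BL2: "ZL2 = BL2"
proof
  show "ZL2 \<subseteq> BL2"
  proof
    fix \<phi> assume \<phi>: "\<phi> \<in> ZL2"
    obtain d where d: "Vector_Spaces.linear scale scale d"
      "\<And>u v. act t (\<lambda>u v. \<phi> u v - \<delta> d u v) u v = 0"
      using invariant_representative[OF \<phi>] by blast
    note \<phi>' = cohomologous_cocycle[OF \<phi> d(1)]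
    obtain d' where d': "Vector_Spaces.linear scale scale d'"
      "\<And>u l. \<phi> u (x l) - \<delta> d u (x l) - \<delta> d' u (x l) = 0"
      using kill_torus[OF \<phi>'(1) d(2)] by blast
    note \<phi>'' = cohomologous_cocycle[OF \<phi>'(1) d'(1)]
    show "\<phi> \<in> BL2"
      using torus_free_coboundary[OF \<phi>''(1) d'(2)] \<phi>'(2) \<phi>''(2) by blast
  qed
qed (rule BL2_subset_ZL2)

lemma HL2_trivial: HL2_trivial
proof -
  have "cohomologous `` {\<phi>} = BL2" if "\<phi> \<in> BL2" for \<phi>
    using that zero_class equiv_class_eq[OF equiv_cohomologous] by (metis Image_singleton_iff)
  then have "ZL2 // cohomologous = {BL2}"
    unfolding ZL2_eq_BL2 quotient_def using zero_in_BL2 by auto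
  then show ?thesis by (simp add: HL2_trivial_def HL2_def)
qed

section \<open>Solvability\<close>

lemma br_span:
  assumes "\<And>u v. u \<in> S \<Longrightarrow> v \<in> S' \<Longrightarrow> br u v \<in> span W" "u \<in> span S" "v \<in> span S'"
  shows "br u v \<in> span W"
  using assms(2)
proof (induction rule: span_induct_alt)
  case (step c u u')
  have "br u v \<in> span W"
    using assms(3) by (induction rule: span_induct_alt)
      (auto intro: span_add span_scale span_zero assms(1) step)
  with step show ?case by (auto intro: span_add span_scale)
qed (simp add: span_zero)

text \<open>The derived series descends from the whole algebra to the nilradical, then to \<open>h\<close> and the blocks, whose
  products all vanish.\<close>

lemma solvable: solvable
proof -
  define N1 where "N1 = insert e (insert h (\<Union>j. range (f j)))"
  define N2 where "N2 = insert h (\<Union>j. range (f j))"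
  have N1: "e \<in> span N1" "h \<in> span N1" "f j i \<in> span N1" for j i
    by (auto simp: N1_def intro!: span_base)
  have N2: "h \<in> span N2" "f j i \<in> span N2" for j i
    by (auto simp: N2_def intro!: span_base)
  have D1: "derived_series (Suc 0) \<subseteq> span N1"
  proof -
    have "br (b g) (b g') \<in> span N1" for g g'
      by (cases g; cases g') (auto simp: br_nil br_torus N1 intro!: span_neg span_scale span_zero)
    then have "br u v \<in> span N1" for u v
      using br_span[of "range b" "range b" N1 u v] span_mono[of "b ` L" "range b"] basis_b(3) by auto
    then show ?thesis
      unfolding derived_series.simps by (intro span_minimal) auto
  qed
  have D2: "derived_series (Suc (Suc 0)) \<subseteq> span N2"
  proof -
    have "br u v \<in> span N2" if "u \<in> N1" "v \<in> N1" for u v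
      using that by (auto simp: N1_def br_nil N2 intro!: span_neg span_zero)
    then have "br u v \<in> span N2" if "u \<in> span N1" "v \<in> span N1" for u v
      using br_span[of N1 N1 N2] that by blast
    then show ?thesis
      unfolding derived_series.simps(2)[of "Suc 0"] using D1 by (intro span_minimal) auto
  qed
  have "br u v \<in> span {}" if "u \<in> N2" "v \<in> N2" for u v
    using that by (auto simp: N2_def br_nil)
  then have "br u v = 0" if "u \<in> span N2" "v \<in> span N2" for u v
    using br_span[of N2 N2 "{}" u v] that by simp
  then have "derived_series (Suc (Suc (Suc 0))) \<subseteq> {0}"
    unfolding derived_series.simps(2)[of "Suc (Suc 0)"] using D2
    by (intro span_minimal) auto
  then have "derived_series (Suc (Suc (Suc 0))) = {0}"
    using span_zero by auto
  then show ?thesis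
    unfolding solvable_def by blast
qed

end

section \<open>Reading the multiplication table in block notation\<close>

context
  fixes k :: nat and n :: "nat \<Rightarrow> nat"
begin

abbreviation "blk \<equiv> \<lambda>j. n (Suc j)"

primrec gen_of :: "label \<Rightarrow> gen" where
  "gen_of Le = E 1"
| "gen_of Lh = H"
| "gen_of (Lx l) = X (Suc l)"
| "gen_of (Lf j i) = E (psum n j + 2 + i)"

lemma psum_Suc [simp]: "psum n (Suc j) = psum n j + n (Suc j)" "psum n 0 = 0"
  by (simp_all add: psum_def)

lemma psum_mono: "j \<le> j' \<Longrightarrow> psum n j \<le> psum n j'"
  by (induction rule: dec_induct) auto

lemma block_unique:
  assumes "psum n j + i = psum n j' + i'" "i < blk j" "i' < blk j'"
  shows "j = j' \<and> i = i'"
proof -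
  have "\<not> j < j'" "\<not> j' < j"
    using psum_mono[of "Suc j" j'] psum_mono[of "Suc j'" j] assms by auto
  then show ?thesis using assms by auto
qed

lemma block_exists: "p < psum n k' \<Longrightarrow> \<exists>j i. j < k' \<and> i < blk j \<and> p = psum n j + i"
proof (induction k')
  case (Suc k')
  show ?case
  proof (cases "p < psum n k'")
    case True
    then show ?thesis using Suc.IH less_SucI by blast
  next
    case False
    then show ?thesis using Suc.prems by (intro exI[of _ k'] exI[of _ "p - psum n k'"]) auto
  qed
qed simp

lemma inj_on_gen_of: "inj_on gen_of (labels k blk)"
proof (rule inj_onI)
  fix a c assume "a \<in> labels k blk" "c \<in> labels k blk" "gen_of a = gen_of c"
  then show "a = c"
  proof (cases a)
    case (Lf j i)
    then obtain j' i' where "c = Lf j' i'"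
      using \<open>gen_of a = gen_of c\<close> by (cases c) auto
    with Lf \<open>a \<in> _\<close> \<open>c \<in> _\<close> \<open>gen_of a = gen_of c\<close> show ?thesis
      using block_unique[of j i j' i'] by simp
  qed (cases c; simp)+
qed

lemma gens_eq: "gens k n = gen_of ` labels k blk"
proof
  show "gen_of ` labels k blk \<subseteq> gens k n"
  proof
    fix a assume "a \<in> gen_of ` labels k blk"
    then obtain g where g: "a = gen_of g" "g \<in> labels k blk" by blast
    show "a \<in> gens k n"
    proof (cases g)
      case (Lf j i)
      then show ?thesis using g psum_mono[of "Suc j" k] by (auto simp: gens_def)
    qed (use g in \<open>auto simp: gens_def\<close>)
  qed
  show "gens k n \<subseteq> gen_of ` labels k blk"
  proof
    fix a assume a: "a \<in> gens k n"
    show "a \<in> gen_of ` labels k blk"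
    proof (cases a)
      case (E p)
      show ?thesis
      proof (cases "p = 1")
        case True
        then show ?thesis using E by (intro image_eqI[of _ _ Le]) auto
      next
        case False
        then have "2 \<le> p" "p - 2 < psum n k"
          using a E by (auto simp: gens_def)
        then obtain j i where "j < k" "i < blk j" "p = psum n j + 2 + i"
          using block_exists[of "p - 2" k] by force
        then show ?thesis using E by (intro image_eqI[of _ _ "Lf j i"]) auto
      qed
    next
      case H
      then show ?thesis by (intro image_eqI[of _ _ Lh]) auto
    next
      case (X l)
      then show ?thesis using a by (intro image_eqI[of _ _ "Lx (l - 1)"]) (auto simp: gens_def)
    qed
  qed
qed

text \<open>In the first block the action of $x_1$ is listed only from $e_3$ on, as $e_2$ has weight zero for it;
  therefore \<open>Lf 0 0\<close> with \<open>Lx 0\<close> is not a listed pair.\<close>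

fun listed :: "label \<Rightarrow> label \<Rightarrow> bool" where
  "listed Le Le \<longleftrightarrow> True"
| "listed (Lf j i) Le \<longleftrightarrow> Suc i < blk j"
| "listed Le (Lf j i) \<longleftrightarrow> Suc i < blk j"
| "listed Le (Lx l) \<longleftrightarrow> l = 0"
| "listed (Lx l) Le \<longleftrightarrow> l = 0"
| "listed Lh (Lx l) \<longleftrightarrow> l = 0"
| "listed (Lf j i) (Lx l) \<longleftrightarrow> l = 0 \<and> (i > 0 \<or> j > 0) \<or> l = Suc j"
| "listed (Lx l) (Lf j i) \<longleftrightarrow> l = 0 \<and> (i > 0 \<or> j > 0) \<or> l = Suc j"
| "listed _ _ \<longleftrightarrow> False"

text \<open>The table treats the first block separately from the others; here the two forms are merged.\<close>

lemma entry_listed: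
  assumes "entry k n a c r g" "k \<ge> 1"
  obtains a' c' where "a' \<in> labels k blk" "c' \<in> labels k blk" "a = gen_of a'" "c = gen_of c'" "listed a' c'"
  using assms(1)
proof cases
  case 1
  with \<open>k \<ge> 1\<close> show ?thesis by (intro that[of Le Le]) auto
next
  case 2
  with \<open>k \<ge> 1\<close> show ?thesis by (intro that[of Lh "Lx 0"]) auto
next
  case (3 i)
  with \<open>k \<ge> 1\<close> show ?thesis by (intro that[of "Lf 0 (i - 2)" Le]) auto
next
  case (4 i)
  with \<open>k \<ge> 1\<close> show ?thesis by (intro that[of Le "Lf 0 (i - 2)"]) auto
next
  case (5 j i)
  with \<open>k \<ge> 1\<close> show ?thesis by (intro that[of "Lf j (i - 2)" Le]) auto
next
  case (6 j i)
  with \<open>k \<ge> 1\<close> show ?thesis by (intro that[of Le "Lf j (i - 2)"]) auto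
next
  case 7
  with \<open>k \<ge> 1\<close> show ?thesis by (intro that[of Le "Lx 0"]) auto
next
  case 8
  with \<open>k \<ge> 1\<close> show ?thesis by (intro that[of "Lx 0" Le]) auto
next
  case (9 i)
  with \<open>k \<ge> 1\<close> show ?thesis by (intro that[of "Lf 0 (i - 2)" "Lx 0"]) auto
next
  case (10 i)
  with \<open>k \<ge> 1\<close> show ?thesis by (intro that[of "Lx 0" "Lf 0 (i - 2)"]) auto
next
  case (11 j i)
  with \<open>k \<ge> 1\<close> show ?thesis by (intro that[of "Lf j (i - 2)" "Lx 0"]) auto
next
  case (12 j i)
  with \<open>k \<ge> 1\<close> show ?thesis by (intro that[of "Lx 0" "Lf j (i - 2)"]) auto
next
  case (13 i)
  with \<open>k \<ge> 1\<close> show ?thesis by (intro that[of "Lf 0 (i - 2)" "Lx 1"]) auto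
next
  case (14 i)
  with \<open>k \<ge> 1\<close> show ?thesis by (intro that[of "Lx 1" "Lf 0 (i - 2)"]) auto
next
  case (15 j i)
  with \<open>k \<ge> 1\<close> show ?thesis by (intro that[of "Lf j (i - 2)" "Lx (Suc j)"]) auto
next
  case (16 j i)
  with \<open>k \<ge> 1\<close> show ?thesis by (intro that[of "Lx (Suc j)" "Lf j (i - 2)"]) auto
qed

lemma entry_block:
  assumes "j < k" "Suc i < blk j"
  shows "entry k n (gen_of (Lf j i)) (E 1) 1 (gen_of (Lf j (Suc i)))"
    "entry k n (E 1) (gen_of (Lf j i)) (-1) (gen_of (Lf j (Suc i)))"
  using assms entry.intros(3,4)[of "i + 2" n k] entry.intros(5,6)[of j k "i + 2" n]
  by (cases "j = 0"; force simp: ac_simps)+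

lemma entry_torus_1:
  assumes "j < k" "i < blk j" "j > 0 \<or> i > 0"
  shows "entry k n (gen_of (Lf j i)) (X 1) (of_nat i) (gen_of (Lf j i))"
    "entry k n (X 1) (gen_of (Lf j i)) (- of_nat i) (gen_of (Lf j i))"
  using assms entry.intros(9,10)[of "i + 2" n k] entry.intros(11,12)[of j k "i + 2" n]
  by (cases "j = 0"; force simp: ac_simps)+

lemma entry_torus_block:
  assumes "j < k" "i < blk j"
  shows "entry k n (gen_of (Lf j i)) (X (j + 2)) 1 (gen_of (Lf j i))"
    "entry k n (X (j + 2)) (gen_of (Lf j i)) (-1) (gen_of (Lf j i))"
  using assms entry.intros(13,14)[of "i + 2" n k] entry.intros(15,16)[of j k "i + 2" n]
  by (cases "j = 0"; force simp: ac_simps numeral_2_eq_2)+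

end

text \<open>The listed products are read off directly; every other product of generators is zero because
  the generator names determine the labels, so that no line of the table applies.\<close>

lemma block_notation:
  fixes k :: nat and n :: "nat \<Rightarrow> nat"
    and scale :: "complex \<Rightarrow> 'b::ab_group_add \<Rightarrow> 'b" (infixr "*s" 75)
    and br :: "'b \<Rightarrow> 'b \<Rightarrow> 'b"
    and v :: "gen \<Rightarrow> 'b"
  assumes k: "k \<ge> 1"
    and n_pos: "\<And>j. j < k \<Longrightarrow> n (Suc j) > 0"
    and "vector_space scale"
    and bilinear: "vector_space.bilinear_map scale br"
    and basis: "vector_space.basis_family scale (gens k n) v"
    and table: "multiplication_table k n scale br v"
  shows "block_leibniz scale br k (\<lambda>j. n (Suc j)) (v (E 1)) (v H)
    (\<lambda>l. if l \<le> k then v (X (Suc l)) else 0)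
    (\<lambda>j i. if j < k \<and> i < n (Suc j) then v (E (psum n j + 2 + i)) else 0)"
proof -
  interpret vector_space scale by fact
  let ?m = "\<lambda>j. n (Suc j)" and ?x = "\<lambda>l. if l \<le> k then v (X (Suc l)) else 0"
    and ?f = "\<lambda>j i. if j < k \<and> i < n (Suc j) then v (E (psum n j + 2 + i)) else 0"
  let ?L = "labels k ?m"
  have lin: "br u 0 = 0" "br 0 u = 0" for u
    using bilinear Vector_Spaces.linear.axioms(3) module_hom.zero unfolding bilinear_map_def by blast+
  have v_gen_of: "case_label (v (E 1)) (v H) ?x ?f g = v (gen_of n g)" if "g \<in> ?L" for g
    using that by (cases g) auto
  have entry: "br (v a) (v c) = r *s v g" if "entry k n a c r g" for a c r g
    using table that by (auto simp: multiplication_table_def)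
  have unlisted: "br (v (gen_of n a)) (v (gen_of n c)) = 0"
    if "a \<in> ?L" "c \<in> ?L" "\<not> listed n a c" for a c
  proof -
    have "\<nexists>r g. entry k n (gen_of n a) (gen_of n c) r g"
      using that entry_listed[OF _ k] inj_onD[OF inj_on_gen_of] by metis
    moreover have "gen_of n a \<in> gens k n" "gen_of n c \<in> gens k n"
      using that by (auto simp: gens_eq)
    ultimately show ?thesis
      using table by (auto simp: multiplication_table_def)
  qed
  show ?thesis
  proof
    show "bilinear_map br" by fact
    have "inj_on (v \<circ> gen_of n) ?L" "v ` gen_of n ` ?L = v ` gens k n"
      using basis comp_inj_on[OF inj_on_gen_of] by (auto simp: basis_family_def gens_eq)
    then show "basis_family ?L (case_label (v (E 1)) (v H) ?x ?f)"
      using basis unfolding basis_family_def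
      by (simp add: v_gen_of cong: inj_on_cong image_cong) (simp add: image_image comp_def)
    show "br (v (E 1)) (v (E 1)) = v H"
      using entry[OF entry.intros(1)] by simp
    show "br (v (E 1)) (v H) = 0" "br (v H) (v (E 1)) = 0" "br (v H) (v H) = 0"
      using unlisted[of Le Lh] unlisted[of Lh Le] unlisted[of Lh Lh] by simp_all
    show "br (?f j i) (v (E 1)) = ?f j (Suc i)" "br (v (E 1)) (?f j i) = - ?f j (Suc i)" for j i
      using unlisted[of "Lf j i" Le] unlisted[of Le "Lf j i"] entry[OF entry_block(1)[of j k i n]]
        entry[OF entry_block(2)[of j k i n]]
      by (auto simp: lin)
    show "br (v H) (?f j i) = 0" "br (?f j i) (v H) = 0" "br (?f j i) (?f j' i') = 0" for j i j' i'
      using unlisted[of Lh "Lf j i"] unlisted[of "Lf j i" Lh] unlisted[of "Lf j i" "Lf j' i'"]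
      by (auto simp: lin)
    show "br (?x l) (?x l') = 0" "br (?x l) (v H) = 0" for l l'
      using unlisted[of "Lx l" "Lx l'"] unlisted[of "Lx l" Lh] by (auto simp: lin)
    show "br (v (E 1)) (?x l) = wt Le l *s v (E 1)" "br (?x l) (v (E 1)) = - (wt Le l *s v (E 1))"
      "br (v H) (?x l) = wt Lh l *s v H" for l
      using unlisted[of Le "Lx l"] unlisted[of "Lx l" Le] unlisted[of Lh "Lx l"]
        entry[OF entry.intros(7)] entry[OF entry.intros(8)] entry[OF entry.intros(2)]
      by (auto simp: lin wt_def)
    show "br (?f j i) (?x l) = wt (Lf j i) l *s ?f j i"
      "br (?x l) (?f j i) = - (wt (Lf j i) l *s ?f j i)" for j i l
    proof -
      consider "Lf j i \<notin> ?L \<or> l > k" | "Lf j i \<in> ?L" "l \<le> k" "l = 0" "j > 0 \<or> i > 0"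
        | "Lf j i \<in> ?L" "l \<le> k" "l = Suc j" | "Lf j i \<in> ?L" "l \<le> k" "\<not> listed n (Lf j i) (Lx l)"
        by (simp only: listed.simps flip: not_le) blast
      then have "br (?f j i) (?x l) = wt (Lf j i) l *s ?f j i \<and>
        br (?x l) (?f j i) = - (wt (Lf j i) l *s ?f j i)"
      proof cases
        case 1
        then show ?thesis by (auto simp: lin wt_def)
      next
        case 2
        then show ?thesis
          using entry[OF entry_torus_1(1)[of j k i n]] entry[OF entry_torus_1(2)[of j k i n]]
          by (auto simp: wt_def)
      next
        case 3
        then show ?thesis
          using entry[OF entry_torus_block(1)[of j k i n]] entry[OF entry_torus_block(2)[of j k i n]]
          by (auto simp: wt_def)
      next
        case 4
        then show ?thesis
          using unlisted[of "Lf j i" "Lx l"] unlisted[of "Lx l" "Lf j i"] by (auto simp: wt_def)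
      qed
      then show "br (?f j i) (?x l) = wt (Lf j i) l *s ?f j i"
        "br (?x l) (?f j i) = - (wt (Lf j i) l *s ?f j i)" by blast+
    qed
  qed (auto simp: n_pos)
qed

theorem theorem21:
  fixes k :: nat and n :: "nat \<Rightarrow> nat"
    and scale :: "complex \<Rightarrow> 'b::ab_group_add \<Rightarrow> 'b"
    and br :: "'b \<Rightarrow> 'b \<Rightarrow> 'b"
    and v :: "gen \<Rightarrow> 'b"
  assumes "k \<ge> 1"
    and "\<And>j. 1 \<le> j \<Longrightarrow> j < k \<Longrightarrow> n j \<ge> n (j + 1)"
    and "n k \<ge> 1"
    and "vector_space scale"
    and "vector_space.bilinear_map scale br"
    and "vector_space.basis_family scale (gens k n) v"
    and "multiplication_table k n scale br v"
  shows "leibniz_algebra scale br \<and> leibniz_algebra.solvable scale br \<and>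
    leibniz_algebra.complete scale br \<and> leibniz_algebra.HL2_trivial scale br"
proof -
  have "n (Suc j) \<ge> n k" if "Suc j \<le> k" for j
    using that
  proof (induction rule: inc_induct)
    case (step j')
    then show ?case using assms(2)[of j'] by (cases j') auto
  qed simp
  then have "n (Suc j) > 0" if "j < k" for j
    using that assms(3) by (metis Suc_leI less_le_trans zero_less_one)
  then interpret block_leibniz scale br k "\<lambda>j. n (Suc j)" "v (E 1)" "v H"
    "\<lambda>l. if l \<le> k then v (X (Suc l)) else 0"
    "\<lambda>j i. if j < k \<and> i < n (Suc j) then v (E (psum n j + 2 + i)) else 0"
    using assms by (intro block_notation)
  show ?thesis
    using leibniz_algebra_axioms solvable complete HL2_trivial by blast
qed

end
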